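(* Let $A\in\mathbb{R}^{m\times n}$ be the coefficient matrix of a fuzzy linear system, let $S=\begin{bmatrix} S_1 & S_2\\ S_2 & S_1\end{bmatrix}\in\mathbb{R}^{2m\times 2n}$ be the associated block-structure matrix, of rank $r$, with $\mathcal{R}(S_2)\subseteq\mathcal{R}(S_1)$, and let $S=LP^{-1}U$ be the decomposition described in the context. If $Q$ is a permutation matrix such that $QL=\begin{bmatrix}L_r & \mathcal{O}\\ K & \mathcal{O}\end{bmatrix}$, where $L_r\in\mathbb{R}^{r\times r}$ has rank $r$ and $K\in\mathbb{R}^{(2m-r)\times r}$, then a $\{1,2,3\}$-inverse of $S$ is $$S^{\{1,2,3\}}=U^{-1}PE^{\{1,2,3\}}Q,\qquad E^{\{1,2,3\}}=\begin{bmatrix}L_r^{-1}F^{-1} & L_r^{-1}F^{-1}G^T\\ \mathcal{O} & \mathcal{O}\end{bmatrix},$$ where $G=KL_r^{-1}$ and $F=I_r+G^TG$.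
   Context: For $A=(d_{ij})\in\mathbb{R}^{m\times n}$, $S_1,S_2\in\mathbb{R}^{m\times n}$ are the matrices with entries $(S_1)_{ij}=d_{ij}$ if $d_{ij}\ge 0$ and $0$ otherwise, and $(S_2)_{ij}=-d_{ij}$ if $d_{ij}<0$ and $0$ otherwise; so $A=S_1-S_2$, and the block-structure matrix associated with $A$ (or with the fuzzy linear system $A\tilde{\mathbf z}=\tilde{\mathbf b}$) is $S=\begin{bmatrix} S_1 & S_2\\ S_2 & S_1\end{bmatrix}$. $\mathcal{R}(M)$ is the range (column space) of $M$, $M^{\dagger}$ the Moore–Penrose inverse, $O,\mathcal{O}$ zero blocks of appropriate size. A $\{1,2,3\}$-inverse of $S$ is a matrix $Y\in\mathbb{R}^{2n\times 2m}$ with $SYS=S$, $YSY=Y$ and $(SY)^T=SY$. CRRMCF (Column Rank Revealing Minimal Canonical Form): let $G$ be a real $p\times q$ matrix of rank $t$, and let $\{(r_k,c_k)\}_{k=1}^{t}$, $c_1<\dots<c_t$, be the positions of the topmost nonzero entries (pivots) of the columns of $G$. $G$ is in CRRMCF if all entries to the right of the pivot entries are zero. Explicitly: $G(r_k,c_k)\neq 0$; $G(i,j)=0$ for all $i$ if $j\notin\{c_1,\dots,c_t\}$; $G(i,c_k)=0$ if $i<r_k$; $G(r_k,j)=0$ if $j>c_k$. A CRRMCF decomposition of a $p\times q$ matrix $M$ is $M=\mathcal{L}U$ with $\mathcal{L}\in\mathbb{R}^{p\times q}$ in CRRMCF and $U\in\mathbb{R}^{q\times q}$ unit upper triangular. The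 decomposition $S=LP^{-1}U$: $S=\mathcal{L}U$ is a CRRMCF decomposition of $S$ with $\mathcal{L}=\begin{bmatrix}\mathcal{L}_{11} & O\\ \mathcal{L}_{21} & \mathcal{L}_{22}\end{bmatrix}$ and $U=\begin{bmatrix}U_{11} & U_{12}\\ O & U_{22}\end{bmatrix}$, where $S_1=\mathcal{L}_{11}U_{11}$ and $S_1-S_2U_{11}^{-1}\mathcal{L}_{11}^{\dagger}S_2=\mathcal{L}_{22}U_{22}$ are CRRMCF decompositions, $\mathcal{L}_{21}=S_2U_{11}^{-1}$, $U_{12}=\mathcal{L}_{11}^{\dagger}S_2$; $P$ is a permutation matrix such that $L=\mathcal{L}P$ is lower triangular. *)

theory Defs
  imports
    "Jordan_Normal_Form.DL_Rank"
    "Jordan_Normal_Form.Gauss_Jordan_Elimination"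
begin

definition S1_mat :: "real mat \<Rightarrow> real mat" where
  "S1_mat A = map_mat (\<lambda>d. if d \<ge> 0 then d else 0) A"

definition S2_mat :: "real mat \<Rightarrow> real mat" where
  "S2_mat A = map_mat (\<lambda>d. if d < 0 then - d else 0) A"

definition block_structure :: "real mat \<Rightarrow> real mat" where
  "block_structure A = four_block_mat (S1_mat A) (S2_mat A) (S2_mat A) (S1_mat A)"

definition mat_rank :: "real mat \<Rightarrow> nat" where
  "mat_rank M = vec_space.rank (dim_row M) M"

definition mat_range :: "real mat \<Rightarrow> real vec set" where
  "mat_range M = vec_space.col_space (dim_row M) M"

(* mat_inverse is option-valued; the result is unspecified if M is not invertible *)
definition inv_mat :: "real mat \<Rightarrow> real mat" where
  "inv_mat M = the (mat_inverse M)"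

definition is_moore_penrose :: "real mat \<Rightarrow> real mat \<Rightarrow> bool" where
  "is_moore_penrose M X \<longleftrightarrow>
     X \<in> carrier_mat (dim_col M) (dim_row M) \<and>
     M * X * M = M \<and> X * M * X = X \<and>
     transpose_mat (M * X) = M * X \<and> transpose_mat (X * M) = X * M"

definition moore_penrose :: "real mat \<Rightarrow> real mat" where
  "moore_penrose M = (THE X. is_moore_penrose M X)"

definition is_inverse_123 :: "real mat \<Rightarrow> real mat \<Rightarrow> bool" where
  "is_inverse_123 M Y \<longleftrightarrow>
     Y \<in> carrier_mat (dim_col M) (dim_row M) \<and>
     M * Y * M = M \<and> Y * M * Y = Y \<and> transpose_mat (M * Y) = M * Y"

definition permutation_matrix :: "nat \<Rightarrow> real mat \<Rightarrow> bool" where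
  "permutation_matrix k P \<longleftrightarrow>
     (\<exists>\<sigma>. \<sigma> permutes {..<k} \<and> P = mat k k (\<lambda>(i, j). if i = \<sigma> j then 1 else 0))"

(* for rectangular matrices; not via upper_triangular, whose index j is bounded
   only by the row index *)
definition lower_triangular_mat :: "real mat \<Rightarrow> bool" where
  "lower_triangular_mat L \<longleftrightarrow>
     (\<forall>i < dim_row L. \<forall>j < dim_col L. i < j \<longrightarrow> L $$ (i, j) = 0)"

definition unit_upper_triangular :: "real mat \<Rightarrow> bool" where
  "unit_upper_triangular U \<longleftrightarrow>
     square_mat U \<and> upper_triangular U \<and> (\<forall>i < dim_row U. U $$ (i, i) = 1)"

(* (rp k, cp k), k < t, are the 0-based pivot positions *)
definition crrmcf :: "real mat \<Rightarrow> bool" where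
  "crrmcf G \<longleftrightarrow> (\<exists>t rp cp. t = mat_rank G \<and>
     strict_mono_on {..<t} cp \<and>
     (\<forall>k < t. rp k < dim_row G \<and> cp k < dim_col G \<and> G $$ (rp k, cp k) \<noteq> 0) \<and>
     (\<forall>j < dim_col G. j \<notin> cp ` {..<t} \<longrightarrow> (\<forall>i < dim_row G. G $$ (i, j) = 0)) \<and>
     (\<forall>k < t. \<forall>i < rp k. G $$ (i, cp k) = 0) \<and>
     (\<forall>k < t. \<forall>j < dim_col G. cp k < j \<longrightarrow> G $$ (rp k, j) = 0))"

definition crrmcf_decomposition :: "real mat \<Rightarrow> real mat \<Rightarrow> real mat \<Rightarrow> bool" where
  "crrmcf_decomposition M Lc U \<longleftrightarrow>
     Lc \<in> carrier_mat (dim_row M) (dim_col M) \<and> crrmcf Lc \<and>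
     U \<in> carrier_mat (dim_col M) (dim_col M) \<and> unit_upper_triangular U \<and>
     M = Lc * U"

end

theory Submission
  imports Defs
begin

text \<open>
  The theorem holds because a \<open>{1,2,3}\<close>-inverse can be carried through the factorisation of \<open>S\<close>.
  Permutation matrices are orthogonal, so \<open>S = L P\<^sup>T U\<close> gives
  \<open>Q S (U\<^sup>-\<^sup>1 P) = Q L\<close>.  The factor on the right only has to be invertible; the factor \<open>Q\<close> on the
  left has to be orthogonal, since the remaining Penrose condition asks for \<open>S Y\<close> to be symmetric
  and \<open>S Y\<close> is the conjugate of \<open>Q L E\<close> by \<open>Q\<close>.  Thus
  (lemma \<open>is_inverse_123_transport\<close>) any \<open>{1,2,3}\<close>-inverse \<open>E\<close> of \<open>Q L\<close> yields the
  \<open>{1,2,3}\<close>-inverse \<open>U\<^sup>-\<^sup>1 P E Q\<close> of \<open>S\<close>.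

  It remains to treat \<open>Q L\<close>, whose nonzero columns are \<open>[L\<^sub>r; K] = [I; G] L\<^sub>r\<close> with \<open>L\<^sub>r\<close>
  invertible (lemma \<open>is_inverse_123_block_column\<close>).
  For \<open>B = [I; G]\<close> the matrix \<open>F = B\<^sup>T B\<close> is positive definite, hence invertible, and the proposed
  \<open>E\<close> has \<open>L\<^sub>r\<^sup>-\<^sup>1 F\<^sup>-\<^sup>1 B\<^sup>T\<close> as its only nonzero rows: \<open>L\<^sub>r\<^sup>-\<^sup>1\<close> times the least-squares
  left inverse of \<open>B\<close>.  Then \<open>Q L E = B F\<^sup>-\<^sup>1 B\<^sup>T\<close> is the orthogonal projection onto the range of
  \<open>B\<close>, which is symmetric and fixes the columns of \<open>Q L\<close>, and \<open>E Q L\<close> is the projection onto the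
  first \<open>r\<close> coordinates, which fixes \<open>E\<close>.
\<close>

lemma inv_mat_inverse:
  assumes M: "M \<in> carrier_mat k k" and det: "det M \<noteq> 0"
  shows "inv_mat M \<in> carrier_mat k k" "M * inv_mat M = 1\<^sub>m k" "inv_mat M * M = 1\<^sub>m k"
proof -
  have "mat_inverse M \<noteq> None"
    using mat_inverse(1)[OF M, of "()"] det_non_zero_imp_unit[OF M det, of "()"] by blast
  then obtain B where "mat_inverse M = Some B" by blast
  with mat_inverse(2)[OF M this]
  show "inv_mat M \<in> carrier_mat k k" "M * inv_mat M = 1\<^sub>m k" "inv_mat M * M = 1\<^sub>m k"
    by (auto simp: inv_mat_def)
qed

lemma mult_left_cancel_mat:
  fixes X Y Z :: "'a :: semiring_1 mat"
  assumes "X \<in> carrier_mat k k" "Y \<in> carrier_mat k k" "Z \<in> carrier_mat k l" "X * Y = 1\<^sub>m k"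
  shows "X * (Y * Z) = Z"
  using assms by (metis assoc_mult_mat left_mult_one_mat)

lemma transpose_inv_mat_symmetric:
  assumes M: "M \<in> carrier_mat k k" and det: "det M \<noteq> 0" and sym: "transpose_mat M = M"
  shows "transpose_mat (inv_mat M) = inv_mat M"
proof -
  note i = inv_mat_inverse[OF M det]
  have "transpose_mat (inv_mat M) * M = 1\<^sub>m k"
    using transpose_mult[OF M i(1)] i(2) sym by simp
  then have "transpose_mat (inv_mat M) * (M * inv_mat M) = inv_mat M"
    using mult_left_cancel_mat[OF _ M i(1)] i(1) by simp
  then show ?thesis using i(1) by (simp add: i(2))
qed

lemma permutation_matrix_orthogonal:
  assumes "permutation_matrix k P"
  shows "P \<in> carrier_mat k k" "P * transpose_mat P = 1\<^sub>m k" "transpose_mat P * P = 1\<^sub>m k"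
proof -
  from assms obtain \<sigma> where \<sigma>: "\<sigma> permutes {..<k}"
    and P: "P = mat k k (\<lambda>(i, j). if i = \<sigma> j then 1 else 0)"
    unfolding permutation_matrix_def by blast
  show c: "P \<in> carrier_mat k k" by (simp add: P)
  show tP: "transpose_mat P * P = 1\<^sub>m k"
  proof (rule eq_matI)
    fix i j assume "i < dim_row (1\<^sub>m k :: real mat)" "j < dim_col (1\<^sub>m k :: real mat)"
    then have ij: "i < k" "j < k" by auto
    have lt: "\<sigma> i < k" using permutes_in_image[OF \<sigma>] ij(1) by auto
    have "(transpose_mat P * P) $$ (i, j)
        = (\<Sum>l\<in>{0..<k}. (if l = \<sigma> i then 1 else 0) * (if l = \<sigma> j then 1 else 0))"
      using ij by (simp add: P scalar_prod_def)
    also have "\<dots> = (\<Sum>l\<in>{0..<k}. if l = \<sigma> i then (if \<sigma> i = \<sigma> j then 1 else 0) else 0)"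
      by (rule sum.cong) auto
    also have "\<dots> = (if \<sigma> i = \<sigma> j then 1 else 0)"
      using lt by simp
    also have "\<dots> = 1\<^sub>m k $$ (i, j)"
      using ij permutes_inj[OF \<sigma>] by (auto dest: injD)
    finally show "(transpose_mat P * P) $$ (i, j) = 1\<^sub>m k $$ (i, j)" .
  qed (use c in auto)
  show "P * transpose_mat P = 1\<^sub>m k"
    using mat_mult_left_right_inverse[OF _ c tP] c by simp
qed

lemma unit_upper_triangular_det:
  assumes U: "U \<in> carrier_mat k k" and ut: "unit_upper_triangular U"
  shows "det U = 1"
proof -
  have "diag_mat U = replicate k 1"
    using U ut by (intro nth_equalityI) (auto simp: diag_mat_def unit_upper_triangular_def)
  then show ?thesis
    using det_upper_triangular[OF _ U] ut by (simp add: unit_upper_triangular_def)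
qed

text \<open>
  Positive definiteness: \<open>v \<bullet> (I + G\<^sup>T G) v = v \<bullet> v + G v \<bullet> G v\<close>, a sum of two nonnegative terms of
  which the first vanishes only at \<open>v = 0\<close>.
\<close>

lemma det_one_plus_gram:
  fixes G :: "real mat"
  assumes G: "G \<in> carrier_mat p k"
  shows "det (1\<^sub>m k + transpose_mat G * G) \<noteq> 0"
proof
  let ?F = "1\<^sub>m k + transpose_mat G * G"
  have F: "?F \<in> carrier_mat k k" using G by simp
  assume "det ?F = 0"
  then obtain v where v: "v \<in> carrier_vec k" "v \<noteq> 0\<^sub>v k" and Fv: "?F *\<^sub>v v = 0\<^sub>v k"
    using det_0_iff_vec_prod_zero_field[OF F] by blast
  have Gv: "G *\<^sub>v v \<in> carrier_vec p" using G v by simp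
  have "v \<bullet> (?F *\<^sub>v v) = v \<bullet> (v + transpose_mat G *\<^sub>v (G *\<^sub>v v))"
    using G v by (simp add: add_mult_distrib_mat_vec[of _ k k])
  also have "\<dots> = v \<bullet> v + v \<bullet> (transpose_mat G *\<^sub>v (G *\<^sub>v v))"
    using G v Gv by (intro scalar_prod_add_distrib[of _ k]) auto
  also have "v \<bullet> (transpose_mat G *\<^sub>v (G *\<^sub>v v)) = (G *\<^sub>v v) \<bullet> (G *\<^sub>v v)"
    using transpose_vec_mult_scalar[OF G v(1) Gv] G v Gv
    by (metis comm_scalar_prod mult_mat_vec_carrier transpose_carrier_mat)
  finally have "v \<bullet> v + (G *\<^sub>v v) \<bullet> (G *\<^sub>v v) = 0"
    using v by (simp add: Fv)
  moreover have "0 \<le> v \<bullet> v" "0 \<le> (G *\<^sub>v v) \<bullet> (G *\<^sub>v v)"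
    by (simp_all add: scalar_prod_def sum_nonneg)
  ultimately have "v \<bullet> v = 0" by linarith
  then have "\<forall>i<k. v $ i = 0"
    using v(1) by (auto simp: scalar_prod_def sum_nonneg_eq_0_iff)
  with v show False by auto
qed

text \<open>
  The equations \<open>S Y S = S\<close> and \<open>Y S Y = Y\<close> survive multiplication of \<open>S\<close> by any invertible
  matrices on the two sides; the symmetry of \<open>S (V E Q) = Q\<^sup>T (Q S V E) Q\<close>
  is where \<open>Q\<^sup>-\<^sup>1 = Q\<^sup>T\<close> enters.
\<close>

lemma is_inverse_123_transport:
  assumes S: "S \<in> carrier_mat p q" and Q: "Q \<in> carrier_mat p p" and V: "V \<in> carrier_mat q q"
    and W: "W \<in> carrier_mat q q"
    and QtQ: "transpose_mat Q * Q = 1\<^sub>m p"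
    and VW: "V * W = 1\<^sub>m q"
    and inv: "is_inverse_123 (Q * S * V) E"
  shows "is_inverse_123 S (V * E * Q)"
proof -
  define N where "N = Q * S * V"
  have N: "N \<in> carrier_mat p q" using S Q V by (simp add: N_def)
  have E: "E \<in> carrier_mat q p" and NEN: "N * E * N = N" and ENE: "E * N * E = E"
    and sym: "transpose_mat (N * E) = N * E"
    using inv N unfolding is_inverse_123_def N_def[symmetric] by auto
  have Qt: "transpose_mat Q \<in> carrier_mat p p" using Q by simp
  have cancelQ: "transpose_mat Q * (Q * Z) = Z" if "Z \<in> carrier_mat p l" for Z l
    using mult_left_cancel_mat[OF Qt Q that QtQ] .
  have S_eq: "S = transpose_mat Q * N * W"
    using S Q V W Qt QtQ VW cancelQ[of "S * V * W" q]
    by (simp add: N_def assoc_mult_mat[of _ p p _ q _ q]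
      assoc_mult_mat[of _ p q _ q _ q] assoc_mult_mat[of _ p p _ p _ q])
  have WV: "W * V = 1\<^sub>m q" using mat_mult_left_right_inverse[OF V W VW] .
  have cancelW: "W * (V * Z) = Z" if "Z \<in> carrier_mat q l" for Z l
    using mult_left_cancel_mat[OF W V that WV] .
  have QQt: "Q * transpose_mat Q = 1\<^sub>m p" using mat_mult_left_right_inverse[OF Qt Q QtQ] .
  have cancelQt: "Q * (transpose_mat Q * Z) = Z" if "Z \<in> carrier_mat p l" for Z l
    using mult_left_cancel_mat[OF Q Qt that QQt] .
  let ?Y = "V * E * Q"
  have Y: "?Y \<in> carrier_mat q p" using V E Q by simp
  have "S * ?Y = transpose_mat Q * (N * (W * (V * (E * Q))))"
    unfolding S_eq using N E Q V W Qt by (simp add: assoc_mult_mat[of _ q q _ p _ p]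
      assoc_mult_mat[of _ p q _ q _ p] assoc_mult_mat[of _ p p _ q _ p])
  also have "W * (V * (E * Q)) = E * Q"
    using E Q by (intro cancelW[where l = p]) simp
  also have "N * (E * Q) = N * E * Q"
    using N E Q by simp
  finally have SY: "S * ?Y = transpose_mat Q * (N * E * Q)" .
  have NE: "N * E \<in> carrier_mat p p" using N E by simp
  have "transpose_mat (S * ?Y) = transpose_mat (N * E * Q) * Q"
    unfolding SY using transpose_mult[OF Qt, of "N * E * Q" p] NE Q by simp
  also have "\<dots> = transpose_mat Q * (N * E) * Q"
    using transpose_mult[OF NE Q] by (simp add: sym)
  also have "\<dots> = S * ?Y"
    unfolding SY using NE Q Qt by (simp add: assoc_mult_mat[of _ p p _ p _ p])
  finally have c3: "transpose_mat (S * ?Y) = S * ?Y" .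
  have "S * ?Y * S = transpose_mat Q * (N * E * (Q * (transpose_mat Q * (N * W))))"
    unfolding SY unfolding S_eq using NE Q Qt N W
    by (simp add: assoc_mult_mat[of _ p p _ p _ q] assoc_mult_mat[of _ p p _ q _ q])
  also have "Q * (transpose_mat Q * (N * W)) = N * W"
    using N W by (intro cancelQt[where l = q]) simp
  also have "N * E * (N * W) = N * W"
    using NE N W NEN by (metis assoc_mult_mat)
  also have "transpose_mat Q * (N * W) = S"
    unfolding S_eq using Qt N W by simp
  finally have c1: "S * ?Y * S = S" .
  have "?Y * S * ?Y = ?Y * (S * ?Y)"
    using Y S by (simp add: assoc_mult_mat[of _ q p _ q _ p])
  also have "\<dots> = V * (E * (Q * (transpose_mat Q * (N * E * Q))))"
    unfolding SY using V E Q Qt NE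
    by (simp add: assoc_mult_mat[of _ q p _ p _ p] assoc_mult_mat[of _ q q _ p _ p])
  also have "Q * (transpose_mat Q * (N * E * Q)) = N * E * Q"
    using NE Q by (intro cancelQt[where l = p]) simp
  also have "E * (N * E * Q) = E * N * E * Q"
    using E N NE Q by (simp add: assoc_mult_mat[of _ q p _ p _ p] assoc_mult_mat[of _ q p _ q _ p])
  also have "V * (E * N * E * Q) = ?Y"
    unfolding ENE using V E Q by simp
  finally have c2: "?Y * S * ?Y = ?Y" .
  show ?thesis
    unfolding is_inverse_123_def carrier_matD[OF S] by (intro conjI Y c1 c2 c3)
qed

text \<open>
  Everything rests on the normal equation \<open>L\<^sub>r + G\<^sup>T K = F L\<^sub>r\<close>, a consequence of
  \<open>K = G L\<^sub>r\<close>.  With \<open>N\<close> the block column and \<open>E\<close> its proposed inverse, it makes \<open>F\<^sup>-\<^sup>1\<close>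
  cancel from \<open>N E N\<close> and reduces \<open>E N\<close> to the projection onto the first \<open>r\<close> coordinates; that
  projection fixes \<open>E\<close>, whose other rows vanish.
\<close>

lemma is_inverse_123_block_column:
  fixes Lr K G F :: "real mat" and p q r :: nat
  assumes Lr: "Lr \<in> carrier_mat r r" and det: "det Lr \<noteq> 0" and K: "K \<in> carrier_mat p r"
    and G_def: "G = K * inv_mat Lr" and F_def: "F = 1\<^sub>m r + transpose_mat G * G"
  shows "is_inverse_123 (four_block_mat Lr (0\<^sub>m r q) K (0\<^sub>m p q))
    (four_block_mat (inv_mat Lr * inv_mat F) (inv_mat Lr * inv_mat F * transpose_mat G)
      (0\<^sub>m q r) (0\<^sub>m q p))"
    (is "is_inverse_123 ?N ?E")
proof -
  define X H T where "X = inv_mat Lr" and "H = inv_mat F" and "T = transpose_mat G"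
  have X: "X \<in> carrier_mat r r" and LX: "Lr * X = 1\<^sub>m r" and XL: "X * Lr = 1\<^sub>m r"
    using inv_mat_inverse[OF Lr det] by (simp_all add: X_def)
  have G: "G \<in> carrier_mat p r" using K X by (simp add: G_def X_def)
  have T: "T \<in> carrier_mat r p" using G by (simp add: T_def)
  have TG: "T * G \<in> carrier_mat r r" using T G by simp
  have F: "F \<in> carrier_mat r r" using TG by (simp add: F_def T_def)
  have detF: "det F \<noteq> 0" unfolding F_def by (rule det_one_plus_gram[OF G])
  have H: "H \<in> carrier_mat r r" and HF: "H * F = 1\<^sub>m r"
    using inv_mat_inverse[OF F detF] by (simp_all add: H_def)
  have "transpose_mat F = F"
    using TG G T transpose_mult[OF T G]
    by (simp add: F_def T_def transpose_add[of _ r r])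
  then have symH: "transpose_mat H = H"
    using transpose_inv_mat_symmetric[OF F detF] by (simp add: H_def)
  have GL: "G * Lr = K"
    using K X Lr XL by (simp add: G_def X_def[symmetric] assoc_mult_mat[of _ p r _ r _ r])
  have HT: "H * T \<in> carrier_mat r p" using H T by simp
  have normal: "Lr + T * K = F * Lr"
    using T G Lr TG by (simp add: F_def T_def[symmetric] GL[symmetric] add_mult_distrib_mat[of _ r r]
      assoc_mult_mat[of _ r p _ r _ r])
  have HN: "H * Lr + H * T * K = Lr"
  proof -
    have "H * Lr + H * T * K = H * (Lr + T * K)"
      using H T Lr K by (simp add: mult_add_distrib_mat[of _ r r _ r] assoc_mult_mat[of _ r r _ p _ r])
    then show ?thesis
      unfolding normal using mult_left_cancel_mat[OF H F Lr HF] by simp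
  qed
  have Ec: "?E \<in> carrier_mat (r + q) (r + p)" and Nc: "?N \<in> carrier_mat (r + p) (r + q)"
    using X H T Lr K by (simp_all add: X_def H_def T_def)
  have E_eq: "?E = four_block_mat (X * H) (X * (H * T)) (0\<^sub>m q r) (0\<^sub>m q p)"
    using X H T by (simp add: X_def[symmetric] H_def[symmetric] T_def[symmetric])
  have LXZ: "Lr * (X * Z) = Z" if "Z \<in> carrier_mat r l" for Z l
    using mult_left_cancel_mat[OF Lr X that LX] .
  have KXZ: "K * (X * Z) = G * Z" if "Z \<in> carrier_mat r l" for Z l
    using K X that by (simp add: G_def X_def[symmetric])
  have "?N * ?E = four_block_mat (Lr * (X * H) + 0\<^sub>m r q * 0\<^sub>m q r)
      (Lr * (X * (H * T)) + 0\<^sub>m r q * 0\<^sub>m q p)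
      (K * (X * H) + 0\<^sub>m p q * 0\<^sub>m q r) (K * (X * (H * T)) + 0\<^sub>m p q * 0\<^sub>m q p)"
    unfolding E_eq
    by (rule mult_four_block_mat[where ?nr1.0 = r and ?n1.0 = r and ?n2.0 = q
        and ?nr2.0 = p and ?nc1.0 = r and ?nc2.0 = p])
      (use Lr K X H HT in auto)
  also have "\<dots> = four_block_mat H (H * T) (G * H) (G * (H * T))"
    unfolding LXZ[OF H] LXZ[OF HT] KXZ[OF H] KXZ[OF HT] using H HT G by simp
  finally have NE: "?N * ?E = four_block_mat H (H * T) (G * H) (G * (H * T))" .
  have sym: "transpose_mat (?N * ?E) = ?N * ?E"
  proof -
    have "transpose_mat (H * T) = G * H" "transpose_mat (G * H) = H * T"
      using transpose_mult[OF H T] transpose_mult[OF G H] symH by (simp_all add: T_def)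
    moreover have "transpose_mat (G * (H * T)) = G * (H * T)"
      using transpose_mult[OF G HT] \<open>transpose_mat (H * T) = G * H\<close> G H T
      by (simp add: T_def[symmetric] assoc_mult_mat[of _ p r _ r _ p])
    ultimately show ?thesis
      unfolding NE using transpose_four_block_mat[of H r r "H * T" p "G * H" p "G * (H * T)"]
        H HT G symH by simp
  qed
  have GHT: "G * (H * T) \<in> carrier_mat p p" using G HT by simp
  have GH: "G * H \<in> carrier_mat p r" using G H by simp
  have GN: "G * H * Lr + G * (H * T) * K = K"
  proof -
    have "G * H * Lr + G * (H * T) * K = G * (H * Lr + H * T * K)"
      using G H T HT Lr K by (simp add: mult_add_distrib_mat[of _ p r _ r] assoc_mult_mat[of _ p r _ p _ r]
        assoc_mult_mat[of _ p r _ r _ r])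
    then show ?thesis unfolding HN GL .
  qed
  have "?N * ?E * ?N = four_block_mat (H * Lr + H * T * K) (H * 0\<^sub>m r q + H * T * 0\<^sub>m p q)
      (G * H * Lr + G * (H * T) * K) (G * H * 0\<^sub>m r q + G * (H * T) * 0\<^sub>m p q)"
    unfolding NE
    by (rule mult_four_block_mat[where ?nr1.0 = r and ?n1.0 = r and ?n2.0 = p
        and ?nr2.0 = p and ?nc1.0 = r and ?nc2.0 = q])
      (use Lr K H HT GH GHT in auto)
  also have "\<dots> = ?N"
    unfolding HN GN using H right_mult_zero_mat[OF HT] right_mult_zero_mat[OF GH]
      right_mult_zero_mat[OF GHT] by simp
  finally have NEN: "?N * ?E * ?N = ?N" .
  have XHN: "X * H * Lr + X * (H * T) * K = 1\<^sub>m r"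
  proof -
    have "X * H * Lr + X * (H * T) * K = X * (H * Lr + H * T * K)"
      using X H T HT Lr K by (simp add: mult_add_distrib_mat[of _ r r _ r] assoc_mult_mat[of _ r r _ p _ r]
        assoc_mult_mat[of _ r r _ r _ r])
    then show ?thesis unfolding HN XL .
  qed
  have XH: "X * H \<in> carrier_mat r r" and XHT: "X * (H * T) \<in> carrier_mat r p"
    using X H HT by simp_all
  have "?E * ?N = four_block_mat (X * H * Lr + X * (H * T) * K)
      (X * H * 0\<^sub>m r q + X * (H * T) * 0\<^sub>m p q)
      (0\<^sub>m q r * Lr + 0\<^sub>m q p * K) (0\<^sub>m q r * 0\<^sub>m r q + 0\<^sub>m q p * 0\<^sub>m p q)"
    unfolding E_eq
    by (rule mult_four_block_mat[where ?nr1.0 = r and ?n1.0 = r and ?n2.0 = p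
        and ?nr2.0 = q and ?nc1.0 = r and ?nc2.0 = q])
      (use Lr K XH XHT in auto)
  also have "\<dots> = four_block_mat (1\<^sub>m r) (0\<^sub>m r q) (0\<^sub>m q r) (0\<^sub>m q q)"
    unfolding XHN using Lr K right_mult_zero_mat[OF XH] right_mult_zero_mat[OF XHT] by simp
  finally have EN: "?E * ?N = four_block_mat (1\<^sub>m r) (0\<^sub>m r q) (0\<^sub>m q r) (0\<^sub>m q q)" .
  have "?E * ?N * ?E = four_block_mat (1\<^sub>m r * (X * H) + 0\<^sub>m r q * 0\<^sub>m q r)
      (1\<^sub>m r * (X * (H * T)) + 0\<^sub>m r q * 0\<^sub>m q p)
      (0\<^sub>m q r * (X * H) + 0\<^sub>m q q * 0\<^sub>m q r) (0\<^sub>m q r * (X * (H * T)) + 0\<^sub>m q q * 0\<^sub>m q p)"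
    unfolding EN unfolding E_eq
    by (rule mult_four_block_mat[where ?nr1.0 = r and ?n1.0 = r and ?n2.0 = q
        and ?nr2.0 = q and ?nc1.0 = r and ?nc2.0 = p])
      (use XH XHT in auto)
  also have "\<dots> = ?E"
    unfolding E_eq using left_mult_zero_mat[OF XH] left_mult_zero_mat[OF XHT]
      left_mult_one_mat[OF XH] left_mult_one_mat[OF XHT]
      right_add_zero_mat[OF XH] right_add_zero_mat[OF XHT] by simp
  finally have ENE: "?E * ?N * ?E = ?E" .
  show ?thesis
    unfolding is_inverse_123_def carrier_matD[OF Nc] by (intro conjI Ec NEN ENE sym)
qed

theorem theorem3p8:
  fixes A S1 S2 S Lc L11 L21 L22 U U11 U12 U22 P L Q Lr K G F E :: "real mat"
    and m n r :: nat
  assumes A: "A \<in> carrier_mat m n"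
    and S1: "S1 = S1_mat A"
    and S2: "S2 = S2_mat A"
    and S: "S = block_structure A"
    and rank_S: "mat_rank S = r"
    and range: "mat_range S2 \<subseteq> mat_range S1"
    and decomp_S: "crrmcf_decomposition S Lc U"
    and Lc: "Lc = four_block_mat L11 (0\<^sub>m m n) L21 L22"
    and U: "U = four_block_mat U11 U12 (0\<^sub>m n n) U22"
    and decomp_S1: "crrmcf_decomposition S1 L11 U11"
    and decomp_Schur:
      "crrmcf_decomposition (S1 - S2 * inv_mat U11 * moore_penrose L11 * S2) L22 U22"
    and L21: "L21 = S2 * inv_mat U11"
    and U12: "U12 = moore_penrose L11 * S2"
    and P: "permutation_matrix (2 * n) P"
    and L: "L = Lc * P"
    and L_lower: "lower_triangular_mat L"
    and Q: "permutation_matrix (2 * m) Q"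
    and Lr: "Lr \<in> carrier_mat r r" and rank_Lr: "mat_rank Lr = r"
    and K: "K \<in> carrier_mat (2 * m - r) r"
    and QL: "Q * L = four_block_mat Lr (0\<^sub>m r (2 * n - r)) K (0\<^sub>m (2 * m - r) (2 * n - r))"
    and G: "G = K * inv_mat Lr"
    and F: "F = 1\<^sub>m r + transpose_mat G * G"
    and E: "E = four_block_mat
                  (inv_mat Lr * inv_mat F) (inv_mat Lr * inv_mat F * transpose_mat G)
                  (0\<^sub>m (2 * n - r) r) (0\<^sub>m (2 * n - r) (2 * m - r))"
  shows "is_inverse_123 S (inv_mat U * P * E * Q)"
proof -
  have Sc: "S \<in> carrier_mat (2 * m) (2 * n)"
    using A by (simp add: S block_structure_def S1_mat_def S2_mat_def mult_2)
  then have Lc_carrier: "Lc \<in> carrier_mat (2 * m) (2 * n)"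
    and Uc: "U \<in> carrier_mat (2 * n) (2 * n)" and U_unit: "unit_upper_triangular U"
    and S_eq: "S = Lc * U"
    using decomp_S by (auto simp: crrmcf_decomposition_def)
  note Pp = permutation_matrix_orthogonal[OF P]
  note Qp = permutation_matrix_orthogonal[OF Q]
  have Lcar: "L \<in> carrier_mat (2 * m) (2 * n)" using Lc_carrier Pp(1) by (simp add: L)
  have detU: "det U \<noteq> 0" using unit_upper_triangular_det[OF Uc U_unit] by simp
  note Ui = inv_mat_inverse[OF Uc detU]
  have detLr: "det Lr \<noteq> 0"
    using rank_Lr Lr vec_space.det_rank_iff[OF Lr] by (auto simp: mat_rank_def)
  \<comment> \<open>Right multiplication by \<open>?V\<close> turns \<open>S\<close> into \<open>L\<close>; it is invertible with inverse \<open>?W\<close>.\<close>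
  let ?V = "inv_mat U * P" and ?W = "transpose_mat P * U"
  have V: "?V \<in> carrier_mat (2 * n) (2 * n)" and W: "?W \<in> carrier_mat (2 * n) (2 * n)"
    using Ui(1) Pp(1) Uc by simp_all
  have PtU: "P * (transpose_mat P * U) = U"
    using mult_left_cancel_mat[OF Pp(1) _ Uc Pp(2)] Pp(1) by simp
  have VW: "?V * ?W = 1\<^sub>m (2 * n)"
    using assoc_mult_mat[OF Ui(1) Pp(1) W] by (simp add: PtU Ui(3))
  have "U * ?V = P"
    using mult_left_cancel_mat[OF Uc Ui(1) Pp(1) Ui(2)] .
  then have SV: "S * ?V = L"
    using assoc_mult_mat[OF Lc_carrier Uc V] by (simp add: S_eq L)
  have "Q * S * ?V = Q * L"
    using assoc_mult_mat[OF Qp(1) Sc V] by (simp add: SV)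
  then have "is_inverse_123 (Q * S * ?V) E"
    unfolding QL E using is_inverse_123_block_column[OF Lr detLr K G F, of "2 * n - r"] by simp
  then show ?thesis
    by (rule is_inverse_123_transport[OF Sc Qp(1) V W Qp(3) VW])
qed

end
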